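(* For every integer $k\ge 0$ there is a constant $C_k$ such that for arbitrarily large $n$ there exists an $n$-vertex ordered graph $(G,\prec)$ that is ordered along a Hamiltonian path, is $(2k+1)$-non-crossing, and in which every induced path has at most $C_k(\log n)^{1/(k+1)}$ vertices.
   Context: Graphs are finite and simple. An ordered graph $(G,\prec)$ is a graph $G$ with a total order $\prec$ on $V(G)$. It is ordered along a Hamiltonian path if, writing $V(G)=\{v_1\prec\dots\prec v_n\}$, $v_iv_{i+1}\in E(G)$ for every $1\le i<n$. A crossing is a pair of edges $ab$, $cd$ with $a\prec c\prec b\prec d$. A set of edges is non-crossing if it contains no crossing. $(G,\prec)$ is $m$-non-crossing if $E(G)$ can be partitioned into $m$ (possibly empty) non-crossing sets. *)

theory Defs
  imports Complex_Main "HOL-Library.Ramsey" "HOL-Library.Disjoint_Sets"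
begin

definition fin_simple_graph :: "'a set \<Rightarrow> 'a set set \<Rightarrow> bool" where
  "fin_simple_graph V E \<longleftrightarrow> finite V \<and> E \<subseteq> [V]\<^bsup>2\<^esup>"

text \<open>The total order is given by its strict part; \<open>(a, b) \<in> r\<close> stands for \<open>a \<prec> b\<close>.\<close>

definition ordered_graph :: "'a set \<Rightarrow> 'a set set \<Rightarrow> 'a rel \<Rightarrow> bool" where
  "ordered_graph V E r \<longleftrightarrow>
     fin_simple_graph V E \<and> r \<subseteq> V \<times> V \<and> strict_linear_order_on V r"

definition path_edges :: "'a list \<Rightarrow> 'a set set" where
  "path_edges p = {{p ! i, p ! Suc i} | i. Suc i < length p}"

definition ordered_along_hamiltonian_path :: "'a set \<Rightarrow> 'a set set \<Rightarrow> 'a rel \<Rightarrow> bool" where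
  "ordered_along_hamiltonian_path V E r \<longleftrightarrow>
     (\<exists>vs. set vs = V \<and> sorted_wrt (\<lambda>a b. (a, b) \<in> r) vs \<and> path_edges vs \<subseteq> E)"

definition crossing :: "'a rel \<Rightarrow> 'a set \<Rightarrow> 'a set \<Rightarrow> bool" where
  "crossing r e f \<longleftrightarrow>
     (\<exists>a b c d. e = {a, b} \<and> f = {c, d} \<and> (a, c) \<in> r \<and> (c, b) \<in> r \<and> (b, d) \<in> r)"

definition non_crossing :: "'a rel \<Rightarrow> 'a set set \<Rightarrow> bool" where
  "non_crossing r F \<longleftrightarrow> \<not> (\<exists>e\<in>F. \<exists>f\<in>F. crossing r e f)"

text \<open>The parts are indexed by \<open>i < m\<close>, so that several of them may be empty.\<close>

definition m_non_crossing :: "nat \<Rightarrow> 'a set set \<Rightarrow> 'a rel \<Rightarrow> bool" where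
  "m_non_crossing m E r \<longleftrightarrow>
     (\<exists>P :: nat \<Rightarrow> 'a set set. (\<Union>i<m. P i) = E \<and> disjoint_family_on P {..<m} \<and>
        (\<forall>i<m. non_crossing r (P i)))"

text \<open>A path is given by its list of vertices. It is induced if the edges of the subgraph
  induced by its vertices are exactly the edges of the path.\<close>

definition induced_path :: "'a set \<Rightarrow> 'a set set \<Rightarrow> 'a list \<Rightarrow> bool" where
  "induced_path V E p \<longleftrightarrow>
     p \<noteq> [] \<and> distinct p \<and> set p \<subseteq> V \<and> {e \<in> E. e \<subseteq> set p} = path_edges p"

end

theory Submission
  imports Defs
begin

text \<open>From a graph \<open>G\<close> along a Hamiltonian path, form \<open>K\<close> by adding a first and a last vertex, both
  adjacent to everything, and then iterate: a tower of height \<open>d\<close> arises from \<open>K\<close> by gluing a tower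
  of height \<open>d - 1\<close> along every edge between consecutive vertices of \<open>K\<close>. If \<open>K\<close> has \<open>M + 1\<close>
  vertices, the tower has \<open>M ^ d + 1\<close>.
  The two ends of a glued tower are adjacent, so an induced path meets the coarsest copy of \<open>K\<close> in a
  subpath, and the rest of it descends into at most two towers of height \<open>d - 1\<close>, starting there at
  an end. Since the ends dominate \<open>K\<close>, such a descent spends at most two new vertices per level;
  hence the longest induced path grows only by \<open>O(d)\<close> when passing from \<open>G\<close> to the tower, while the
  number of vertices is raised to the power \<open>d\<close>. Edges from different copies of \<open>K\<close> never cross, so
  the tower needs as many classes as \<open>K\<close>, that is, two more than \<open>G\<close> (one for the star of each end).
  Starting from a single vertex, where \<open>K\<close> is a triangle and needs one class, \<open>k + 1\<close> rounds of height
  \<open>l\<close> give at least \<open>2 ^ l ^ (k + 1)\<close> vertices, \<open>2 k + 1\<close> classes and induced paths of order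
  \<open>O(k l)\<close>.\<close>

section \<open>Graphs along a Hamiltonian path and the two constructions on them\<close>

text \<open>Vertices are \<open>0, \<dots>, n\<close> in their natural order, so there are \<open>n + 1\<close> of them.\<close>

locale hgraph =
  fixes n :: nat and R :: "nat \<Rightarrow> nat \<Rightarrow> bool"
  assumes sym: "R x y \<Longrightarrow> R y x"
    and neq: "R x y \<Longrightarrow> x \<noteq> y"
    and le: "R x y \<Longrightarrow> x \<le> n"
    and consec: "i < n \<Longrightarrow> R i (Suc i)"

text \<open>The empty list is allowed, so every infix of an induced path is again one.\<close>

definition ipath :: "nat \<Rightarrow> (nat \<Rightarrow> nat \<Rightarrow> bool) \<Rightarrow> nat list \<Rightarrow> bool" where
  "ipath n R p \<longleftrightarrow> distinct p \<and> set p \<subseteq> {..n} \<and>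
     (\<forall>i<length p. \<forall>j<length p. R (p ! i) (p ! j) \<longleftrightarrow> i = Suc j \<or> j = Suc i)"

text \<open>Encodes a partition of the edges into \<open>m\<close> non-crossing classes. The values
  of \<open>col\<close> matter only on edges written with the smaller vertex first.\<close>

definition nc_colouring :: "nat \<Rightarrow> (nat \<Rightarrow> nat \<Rightarrow> bool) \<Rightarrow> (nat \<Rightarrow> nat \<Rightarrow> nat) \<Rightarrow> bool" where
  "nc_colouring m R col \<longleftrightarrow> (\<forall>x y. x < y \<longrightarrow> R x y \<longrightarrow> col x y < m) \<and>
     (\<forall>a b c e. a < c \<longrightarrow> c < b \<longrightarrow> b < e \<longrightarrow> R a b \<longrightarrow> R c e \<longrightarrow> col a b \<noteq> col c e)"

text \<open>The new vertices are \<open>0\<close> and \<open>n + 2\<close>; an old vertex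
  \<open>v\<close> becomes \<open>v + 1\<close>. Truncated subtraction is harmless, since
  \<open>R\<close> decides only when neither vertex is new.\<close>

definition apex :: "nat \<Rightarrow> (nat \<Rightarrow> nat \<Rightarrow> bool) \<Rightarrow> nat \<Rightarrow> nat \<Rightarrow> bool" where
  "apex n R x y \<longleftrightarrow> x \<noteq> y \<and> x \<le> n + 2 \<and> y \<le> n + 2 \<and>
     (x \<in> {0, n + 2} \<or> y \<in> {0, n + 2} \<or> R (x - 1) (y - 1))"

text \<open>The coarsest copy of \<open>K\<close> sits on the multiples of \<open>M ^ d\<close>. The
  gap from \<open>q * M ^ d\<close> to \<open>Suc q * M ^ d\<close>, both ends included, carries a
  translate of the tower of height \<open>d\<close>. Height 0 is a single edge.\<close>

fun tower :: "(nat \<Rightarrow> nat \<Rightarrow> bool) \<Rightarrow> nat \<Rightarrow> nat \<Rightarrow> nat \<Rightarrow> nat \<Rightarrow> bool" where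
  "tower K M 0 x y \<longleftrightarrow> x = 0 \<and> y = 1 \<or> x = 1 \<and> y = 0"
| "tower K M (Suc d) x y \<longleftrightarrow>
     (\<exists>a b. K a b \<and> x = a * M ^ d \<and> y = b * M ^ d) \<or>
     (\<exists>q<M. \<exists>a b. tower K M d a b \<and> x = q * M ^ d + a \<and> y = q * M ^ d + b)"

section \<open>Induced paths as lists\<close>

lemma ipath_nth:
  "ipath n R p \<Longrightarrow> i < length p \<Longrightarrow> j < length p \<Longrightarrow> R (p ! i) (p ! j) \<longleftrightarrow> i = Suc j \<or> j = Suc i"
  unfolding ipath_def by blast

lemma ipath_infix:
  assumes "ipath n R (a @ b @ c)"
  shows "ipath n R b"
proof -
  have "R (b ! i) (b ! j) \<longleftrightarrow> i = Suc j \<or> j = Suc i" if "i < length b" "j < length b" for i j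
    using ipath_nth[OF assms, of "length a + i" "length a + j"] that by (simp add: nth_append)
  with assms show ?thesis
    by (simp add: ipath_def)
qed

lemma ipath_rev:
  assumes "ipath n R p"
  shows "ipath n R (rev p)"
proof -
  have "R (rev p ! i) (rev p ! j) \<longleftrightarrow> i = Suc j \<or> j = Suc i"
    if ij: "i < length p" "j < length p" for i j
  proof -
    have "R (rev p ! i) (rev p ! j) \<longleftrightarrow>
        length p - Suc i = Suc (length p - Suc j) \<or> length p - Suc j = Suc (length p - Suc i)"
      using ipath_nth[OF assms, of "length p - Suc i" "length p - Suc j"] ij by (simp add: rev_nth)
    also have "\<dots> \<longleftrightarrow> i = Suc j \<or> j = Suc i"
      using ij by linarith
    finally show ?thesis .
  qed
  with assms show ?thesis
    by (simp add: ipath_def)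
qed

lemma ipath_map:
  assumes "ipath n R p" and "inj_on g (set p)" and "\<And>x. x \<in> set p \<Longrightarrow> g x \<le> n'"
    and "\<And>x y. x \<in> set p \<Longrightarrow> y \<in> set p \<Longrightarrow> R' (g x) (g y) \<longleftrightarrow> R x y"
  shows "ipath n' R' (map g p)"
  using assms by (auto simp: ipath_def distinct_map)

lemma ipath_adjacent:
  assumes "ipath n R (a @ x # y # b)"
  shows "R x y"
proof -
  have "ipath n R [x, y]"
    using ipath_infix[of n R a "[x, y]" b] assms by simp
  then have "R ([x, y] ! 0) ([x, y] ! 1)"
    unfolding ipath_def by (metis One_nat_def length_Cons less_Suc_eq_0_disj)
  then show ?thesis by simp
qed

lemma ipath_not_adjacent:
  assumes "ipath n R (x # ps @ [y])" and "ps \<noteq> []"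
  shows "\<not> R x y"
  using ipath_nth[OF assms(1), of 0 "Suc (length ps)"] assms(2) by simp

text \<open>All other vertices of the path are neighbours of \<open>u\<close>, and on an induced
  path these are its predecessor and its successor.\<close>

lemma ipath_length_dominated:
  assumes "ipath n R p" and "u \<in> set p" and dom: "\<And>x. x \<in> set p \<Longrightarrow> x \<noteq> u \<Longrightarrow> R u x"
  shows "length p \<le> 3"
proof -
  obtain i where i: "i < length p" "p ! i = u"
    using assms(2) by (auto simp: in_set_conv_nth)
  have "{..<length p} \<subseteq> {i - 1, i, Suc i}"
  proof
    fix j assume "j \<in> {..<length p}"
    then have j: "j < length p" by simp
    show "j \<in> {i - 1, i, Suc i}"
    proof (cases "j = i")
      case False
      then have "p ! j \<noteq> u"
        using assms(1) i j by (auto simp: ipath_def nth_eq_iff_index_eq)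
      then have "R (p ! i) (p ! j)"
        using dom[of "p ! j"] i j by simp
      then have "i = Suc j \<or> j = Suc i"
        using assms(1) i j unfolding ipath_def by blast
      then show ?thesis by auto
    qed simp
  qed
  then have "card {..<length p} \<le> card {i - 1, i, Suc i}"
    by (intro card_mono) auto
  also have "\<dots> \<le> 3"
    by (simp add: card_insert_if)
  finally show ?thesis by simp
qed

lemma butlast_last_append: "xs \<noteq> [] \<Longrightarrow> butlast xs @ last xs # ys = xs @ ys"
  by (induction xs) auto

section \<open>Adding two dominating ends\<close>

lemma apex_hgraph:
  assumes "hgraph n R"
  shows "hgraph (n + 2) (apex n R)"
proof -
  interpret hgraph n R by fact
  show ?thesis
  proof
    fix i assume i: "i < n + 2"
    show "apex n R i (Suc i)"
    proof (cases i)
      case (Suc i')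
      then show ?thesis
        using i consec[of i'] by (cases "i' < n") (auto simp: apex_def)
    qed (simp add: apex_def)
  qed (auto simp: apex_def dest: sym)
qed

lemma ipath_apex_end:
  assumes "ipath (n + 2) (apex n R) p" and "u \<in> set p" and "u \<in> {0, n + 2}"
  shows "length p \<le> 3"
proof (rule ipath_length_dominated[OF assms(1,2)])
  fix x assume "x \<in> set p" "x \<noteq> u"
  then show "apex n R u x"
    using assms by (auto simp: apex_def ipath_def)
qed

text \<open>Either the path meets a dominating end, or shifting it down by one gives an induced path
  of \<open>R\<close>.\<close>

lemma ipath_apex:
  assumes "ipath (n + 2) (apex n R) p" and "hgraph n R"
    and g: "\<And>p. ipath n R p \<Longrightarrow> length p \<le> g"
  shows "length p \<le> max 3 g"
proof (cases "set p \<inter> {0, n + 2} = {}")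
  case True
  then have *: "0 < x" "x < n + 2" if "x \<in> set p" for x
    using that assms(1) by (fastforce simp: ipath_def)+
  interpret hgraph n R by fact
  have "ipath n R (map (\<lambda>x. x - 1) p)"
  proof (rule ipath_map[OF assms(1)])
    show "inj_on (\<lambda>x. x - 1) (set p)"
      using * by (metis (no_types, lifting) Suc_pred' diff_Suc_1 inj_onI One_nat_def)
    fix x y assume "x \<in> set p" "y \<in> set p"
    then show "R (x - 1) (y - 1) \<longleftrightarrow> apex n R x y"
      using *[of x] *[of y] neq[of "x - 1" "y - 1"] by (auto simp: apex_def)
  qed (use * in fastforce)
  from g[OF this] show ?thesis by simp
next
  case False
  then show ?thesis
    using ipath_apex_end[OF assms(1)] by fastforce
qed

text \<open>Edges sharing a vertex never cross, so the star of \<open>0\<close> forms class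
  \<open>m\<close> and the remaining edges at \<open>n + 2\<close> form class \<open>m + 1\<close>.
  Old edges keep their class.\<close>

lemma nc_colouring_apex:
  assumes "nc_colouring m R col"
  shows "nc_colouring (m + 2) (apex n R)
    (\<lambda>x y. if x = 0 then m else if y = n + 2 then m + 1 else col (x - 1) (y - 1))"
  unfolding nc_colouring_def
proof (intro conjI allI impI)
  have less: "col x y < m" if "x < y" "R x y" for x y
    using assms that by (simp add: nc_colouring_def)
  fix x y :: nat assume "x < y" "apex n R x y"
  moreover from this have "x - 1 < y - 1" if "x \<noteq> 0"
    using that by linarith
  moreover from calculation have "x \<noteq> 0 \<Longrightarrow> y \<noteq> n + 2 \<Longrightarrow> R (x - 1) (y - 1)"
    by (auto simp: apex_def)
  ultimately show "(if x = 0 then m else if y = n + 2 then m + 1 else col (x - 1) (y - 1)) < m + 2"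
    using less[of "x - 1" "y - 1"] by (auto intro: less_trans)
next
  have less: "col x y < m" if "x < y" "R x y" for x y
    using assms that by (simp add: nc_colouring_def)
  fix a b c e :: nat
  assume *: "a < c" "c < b" "b < e" "apex n R a b" "apex n R c e"
  then have "e \<le> n + 2" by (simp add: apex_def)
  with * have r: "R (c - 1) (e - 1)" if "e \<noteq> n + 2"
    using that by (auto simp: apex_def)
  have s: "R (a - 1) (b - 1)" if "a \<noteq> 0"
    using that * \<open>e \<le> n + 2\<close> by (auto simp: apex_def)
  have "col (a - 1) (b - 1) \<noteq> col (c - 1) (e - 1)" if "a \<noteq> 0" "e \<noteq> n + 2"
    using r s * that assms by (simp add: nc_colouring_def)
  moreover have "col (a - 1) (b - 1) < m" if "a \<noteq> 0"
    using less s * that by simp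
  moreover have "col (c - 1) (e - 1) < m" if "e \<noteq> n + 2"
    using less r * that by simp
  ultimately show "(if a = 0 then m else if b = n + 2 then m + 1 else col (a - 1) (b - 1)) \<noteq>
      (if c = 0 then m else if e = n + 2 then m + 1 else col (c - 1) (e - 1))"
    using *(1-3) \<open>e \<le> n + 2\<close> by (auto split: if_splits)
qed

text \<open>A crossing needs four vertices, and here there are three. Using one class instead of two
  at the start is what makes the final count \<open>2 * k + 1\<close>.\<close>

lemma nc_colouring_apex_vertex: "nc_colouring 1 (apex 0 R) (\<lambda>_ _. 0)"
  by (auto simp: nc_colouring_def apex_def)

section \<open>Towers and how their levels fit together\<close>

text \<open>Two different gaps of length \<open>L\<close> have at most one point in common: the
  right end of one and the left end of the next.\<close>

lemma mult_add_inj: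
  fixes q L a q' a' :: nat
  assumes "q * L + a = q' * L + a'" and "a \<le> L" "a' \<le> L" and "q < q'" and "L > 0"
  shows "a = L \<and> a' = 0 \<and> q' = Suc q"
proof -
  obtain k where k: "q' = Suc (q + k)"
    using less_imp_Suc_add[OF assms(4)] by auto
  then have "q * L + a = q * L + L + k * L + a'"
    using assms(1) by (simp add: algebra_simps)
  then have "a = L" "a' = 0" "k * L = 0"
    using assms(2) by linarith+
  with k \<open>L > 0\<close> show ?thesis by simp
qed

lemma mult_eq_mult_add:
  fixes x q L a :: nat
  assumes "x * L = q * L + a" and "a \<le> L" and "L > 0"
  shows "x = q \<and> a = 0 \<or> x = Suc q \<and> a = L"
proof -
  have "q * L \<le> x * L" "x * L \<le> Suc q * L"
    using assms(1,2) by simp_all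
  then have "q \<le> x" "x \<le> Suc q"
    using assms(3) mult_le_cancel2 by blast+
  then have "x = q \<or> x = Suc q" by linarith
  then show ?thesis
    using assms(1) by auto
qed

text \<open>Collects what the towers take from the apex construction: adjacent ends make the ends of
  every glued tower adjacent, and \<open>ends_path\<close> controls the descent through the
  levels.\<close>

locale tower_base = hgraph M K for M K +
  assumes M: "M \<ge> 2" and ends: "K 0 M"
    and ends_path: "ipath M K p \<Longrightarrow> u \<in> set p \<Longrightarrow> u \<in> {0, M} \<Longrightarrow> length p \<le> 3"
begin

lemma tower_le: "tower K M d x y \<Longrightarrow> x \<le> M ^ d"
proof (induction d arbitrary: x y)
  case (Suc d)
  then consider a b where "K a b" "x = a * M ^ d"
    | q a b where "q < M" "tower K M d a b" "x = q * M ^ d + a" by auto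
  then show ?case
  proof cases
    case 1
    then show ?thesis using le by simp
  next
    case 2
    then have "x \<le> Suc q * M ^ d" using Suc.IH by simp
    also have "\<dots> \<le> M * M ^ d" using 2 by (intro mult_le_mono1) simp
    finally show ?thesis by simp
  qed
qed auto

lemma tower_sym: "tower K M d x y \<Longrightarrow> tower K M d y x"
proof (induction d arbitrary: x y)
  case (Suc d)
  then show ?case unfolding tower.simps using sym by blast
qed auto

lemma tower_neq: "tower K M d x y \<Longrightarrow> x \<noteq> y"
proof (induction d arbitrary: x y)
  case (Suc d)
  then show ?case using neq M by fastforce
qed auto

lemma tower_ends: "tower K M d 0 (M ^ d)"
proof (cases d)
  case (Suc e)
  then show ?thesis using ends by auto
qed simp

lemma tower_consec: "i < M ^ d \<Longrightarrow> tower K M d i (Suc i)"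
proof (induction d arbitrary: i)
  case (Suc d)
  let ?L = "M ^ d"
  have L: "?L > 0" using M by simp
  have "i div ?L < M"
    using Suc.prems by (simp add: less_mult_imp_div_less)
  moreover have "tower K M d (i mod ?L) (Suc (i mod ?L))"
    using L by (intro Suc.IH) simp
  moreover have "i = i div ?L * ?L + i mod ?L" by (rule div_mult_mod_eq[symmetric])
  moreover from this have "Suc i = i div ?L * ?L + Suc (i mod ?L)" by simp
  ultimately show ?case
    unfolding tower.simps by blast
qed simp

lemma tower_hgraph: "hgraph (M ^ d) (tower K M d)"
  by unfold_locales (auto intro: tower_sym tower_le tower_consec dest: tower_neq)

text \<open>An edge inside a gap that joins two multiples of \<open>M ^ d\<close> joins the two ends
  of that gap, and these are consecutive, hence adjacent, in \<open>K\<close>.\<close>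

lemma tower_coarse:
  "tower K M (Suc d) (a * M ^ d) (b * M ^ d) \<longleftrightarrow> K a b"
proof
  let ?L = "M ^ d"
  have L: "?L > 0" using M by simp
  assume "tower K M (Suc d) (a * ?L) (b * ?L)"
  then consider "K a b"
    | q x y where "q < M" "tower K M d x y" "a * ?L = q * ?L + x" "b * ?L = q * ?L + y"
    using L by auto
  then show "K a b"
  proof cases
    case 2
    note * = mult_eq_mult_add[OF _ _ L]
    have "x \<le> ?L" "y \<le> ?L" "x \<noteq> y"
      using 2 tower_le tower_sym tower_neq by blast+
    then show ?thesis
      using *[OF 2(3)] *[OF 2(4)] consec[OF 2(1)] sym by metis
  qed
qed auto

text \<open>No other edge interferes with a gap: a coarse edge within it joins its ends, which
  \<open>tower_ends\<close> makes adjacent already, and another gap shares at most one vertex with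
  it.\<close>

lemma tower_gap:
  assumes "q < M" "a \<le> M ^ d" "b \<le> M ^ d"
  shows "tower K M (Suc d) (q * M ^ d + a) (q * M ^ d + b) \<longleftrightarrow> tower K M d a b"
proof
  let ?L = "M ^ d"
  have L: "?L > 0" using M by simp
  assume "tower K M (Suc d) (q * ?L + a) (q * ?L + b)"
  then consider x y where "K x y" "q * ?L + a = x * ?L" "q * ?L + b = y * ?L"
    | q' x y where "tower K M d x y" "q * ?L + a = q' * ?L + x" "q * ?L + b = q' * ?L + y"
    by auto
  then show "tower K M d a b"
  proof cases
    case 1
    note * = mult_eq_mult_add[OF _ _ L]
    show ?thesis
      using *[OF 1(2)[symmetric] assms(2)] *[OF 1(3)[symmetric] assms(3)] neq[OF 1(1)] tower_ends[of d] tower_sym by auto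
  next
    case 2
    have xy: "x \<le> ?L" "y \<le> ?L" "x \<noteq> y"
      using 2 tower_le tower_sym tower_neq by blast+
    consider "q < q'" | "q' < q" | "q = q'" by linarith
    then show ?thesis
    proof cases
      case 1
      then show ?thesis
        using mult_add_inj[OF 2(2) assms(2) xy(1)] mult_add_inj[OF 2(3) assms(3) xy(2)] xy L by simp
    next
      case u: 2
      then show ?thesis
        using mult_add_inj[OF 2(2)[symmetric] xy(1) assms(2)]
          mult_add_inj[OF 2(3)[symmetric] xy(2) assms(3)] xy L by simp
    next
      case 3
      then show ?thesis using 2 by simp
    qed
  qed
qed (use assms in auto)

text \<open>A vertex that is no multiple of \<open>M ^ d\<close> is interior to one gap, and all its
  edges come from the tower glued there.\<close>

lemma tower_fine:
  assumes "tower K M (Suc d) x y" and "\<not> M ^ d dvd x"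
  shows "x div M ^ d < M" and "y \<in> {x div M ^ d * M ^ d .. x div M ^ d * M ^ d + M ^ d}"
proof -
  let ?L = "M ^ d"
  from assms obtain q a b where *: "q < M" "tower K M d a b" "x = q * ?L + a" "y = q * ?L + b"
    by auto
  have "a \<le> ?L" "b \<le> ?L"
    using * tower_le tower_sym by blast+
  moreover have "a \<noteq> ?L"
    using assms(2) * by auto
  ultimately show "x div ?L < M" "y \<in> {x div ?L * ?L .. x div ?L * ?L + ?L}"
    using * by simp_all
qed

declare tower.simps(2) [simp del]

section \<open>Splitting an induced path into coarse and fine runs\<close>

lemma fine_div_eq:
  fixes y q L :: nat
  assumes "y \<in> {q * L .. q * L + L}" and "\<not> L dvd y"
  shows "y div L = q"
proof -
  have "y \<noteq> q * L" "y \<noteq> Suc q * L"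
    using assms(2) by auto
  then show ?thesis
    using assms(1) by (intro div_nat_eqI) (auto simp: mult.commute)
qed

text \<open>The summand \<open>0\<close> keeps both alternatives in the form
  \<open>q * L + a\<close> of \<open>tower_gap\<close>.\<close>

lemma fine_gap_ends:
  fixes y q L :: nat
  assumes "y \<in> {q * L .. q * L + L}" and "L dvd y" and "L > 0"
  shows "y = q * L + 0 \<or> y = q * L + L"
proof -
  obtain k where "y = k * L"
    using assms(2) by (metis dvdE mult.commute)
  then show ?thesis
    using mult_eq_mult_add[of k L q "y - q * L"] assms by (metis le_add_diff_inverse atLeastAtMost_iff le_diff_conv add.commute)
qed

lemma ipath_fine_div:
  assumes "ipath n (tower K M (Suc d)) p" and "\<And>x. x \<in> set p \<Longrightarrow> \<not> M ^ d dvd x"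
    and "i < length p"
  shows "p ! i div M ^ d = p ! 0 div M ^ d"
  using assms(3)
proof (induction i)
  case (Suc i)
  then have "tower K M (Suc d) (p ! i) (p ! Suc i)"
    using assms(1) Suc_lessD unfolding ipath_def by blast
  then have "p ! Suc i \<in> {p ! i div M ^ d * M ^ d .. p ! i div M ^ d * M ^ d + M ^ d}"
    using tower_fine(2) assms(2) Suc.prems by (meson Suc_lessD nth_mem)
  then have "p ! Suc i div M ^ d = p ! i div M ^ d"
    by (rule fine_div_eq) (use assms(2) Suc.prems in auto)
  with Suc show ?case by simp
qed simp

text \<open>A run of interior vertices cannot leave its gap without visiting an end. The lists
  \<open>u\<close> and \<open>v\<close> hold an optional neighbour on either side, which then lies
  in the same closed gap.\<close>

lemma ipath_fine:
  assumes "ipath (M ^ Suc d) (tower K M (Suc d)) (u @ p @ v)" and "p \<noteq> []"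
    and p: "\<And>x. x \<in> set p \<Longrightarrow> \<not> M ^ d dvd x"
    and "length u \<le> 1" "length v \<le> 1"
  obtains q where "q < M" and "set (u @ p @ v) \<subseteq> {q * M ^ d .. q * M ^ d + M ^ d}"
proof -
  let ?L = "M ^ d"
  let ?q = "hd p div ?L"
  let ?gap = "{?q * ?L .. ?q * ?L + ?L}"
  have L: "?L > 0" using M by simp
  have ip: "ipath (M ^ Suc d) (tower K M (Suc d)) p"
    using ipath_infix assms(1) by blast
  have div: "x div ?L = ?q" if "x \<in> set p" for x
  proof -
    from that obtain i where "i < length p" "x = p ! i"
      by (metis in_set_conv_nth)
    then show ?thesis
      using ipath_fine_div[OF ip p, of i] by (simp only: hd_conv_nth[OF assms(2)])
  qed
  have near: "y \<in> ?gap" if "x \<in> set p" "tower K M (Suc d) x y" for x y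
    using tower_fine(2)[OF that(2) p[OF that(1)]] unfolding div[OF that(1)] .
  have "hd p < M * ?L"
  proof -
    have "hd p \<le> M * ?L" "hd p \<noteq> M * ?L"
      using ip assms(2) p[of "hd p"] by (auto simp: ipath_def subset_iff)
    then show ?thesis by simp
  qed
  then have "?q < M"
    by (rule less_mult_imp_div_less)
  moreover have "x \<in> ?gap" if "x \<in> set p" for x
  proof -
    have "x = ?q * ?L + x mod ?L"
      using div[OF that] by (metis div_mult_mod_eq)
    moreover have "x mod ?L < ?L" using L by simp
    ultimately show ?thesis
      by (metis atLeastAtMost_iff le_add1 less_imp_le nat_add_left_cancel_le)
  qed
  moreover have "x \<in> ?gap" if "x \<in> set u" for x
  proof -
    have u: "u = [x]" using that assms(4) by (cases u) auto
    have "[] @ x # hd p # tl p @ v = u @ p @ v"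
      using assms(2) u by simp
    then have "tower K M (Suc d) x (hd p)"
      using ipath_adjacent[of _ _ "[]" x "hd p" "tl p @ v"] assms(1) by (simp only:)
    then show ?thesis
      using near[of "hd p" x] tower_sym assms(2) by simp
  qed
  moreover have "x \<in> ?gap" if "x \<in> set v" for x
  proof -
    have v: "v = [x]" using that assms(5) by (cases v) auto
    have "u @ butlast p @ last p # x # [] = u @ p @ v"
      using assms(2) v by (simp add: butlast_last_append)
    then have "tower K M (Suc d) (last p) x"
      using ipath_adjacent[of _ _ "u @ butlast p" "last p" x "[]"] assms(1)
      by (simp only: append_assoc)
    then show ?thesis
      using near[of "last p" x] assms(2) by simp
  qed
  ultimately show ?thesis
    by (intro that[of ?q]) auto
qed

lemma ipath_gap:
  assumes "ipath n (tower K M (Suc d)) p" and "q < M"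
    and p: "set p \<subseteq> {q * M ^ d .. q * M ^ d + M ^ d}"
  shows "ipath (M ^ d) (tower K M d) (map (\<lambda>x. x - q * M ^ d) p)"
proof (rule ipath_map[OF assms(1)])
  let ?L = "M ^ d"
  have *: "q * ?L \<le> x" "x - q * ?L \<le> ?L" if "x \<in> set p" for x
    using p that by fastforce+
  then show "inj_on (\<lambda>x. x - q * ?L) (set p)"
    by (simp add: inj_on_diff_nat)
  fix x y assume xy: "x \<in> set p" "y \<in> set p"
  show "x - q * ?L \<le> ?L"
    using *(2) xy(1) .
  show "tower K M d (x - q * ?L) (y - q * ?L) \<longleftrightarrow> tower K M (Suc d) x y"
    using tower_gap[OF assms(2) *(2)[OF xy(1)] *(2)[OF xy(2)]] *(1) xy
    by (simp only: le_add_diff_inverse)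
qed

text \<open>If the path left the coarse vertices and came back, the excursion would stay in one gap
  and run between its two ends. These are adjacent, so the path would have a chord.\<close>

lemma coarse_contiguous:
  assumes "ipath (M ^ Suc d) (tower K M (Suc d)) p"
  obtains a b c where "p = a @ b @ c" "b = [] \<Longrightarrow> c = []"
    "\<And>x. x \<in> set b \<Longrightarrow> M ^ d dvd x" "\<And>x. x \<in> set a \<union> set c \<Longrightarrow> \<not> M ^ d dvd x"
proof -
  let ?D = "\<lambda>x. M ^ d dvd x"
  define r where "r = dropWhile (\<lambda>x. \<not> ?D x) p"
  define c where "c = dropWhile ?D r"
  define a where "a = takeWhile (\<lambda>x. \<not> ?D x) p"
  have p: "p = a @ takeWhile ?D r @ c"
    by (simp add: a_def r_def c_def)
  have empty: "c = []" if "takeWhile ?D r = []"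
  proof (rule ccontr)
    assume "c \<noteq> []"
    then have "r \<noteq> []" by (auto simp: c_def)
    then have "?D (hd r)"
      using hd_dropWhile[of "\<lambda>x. \<not> ?D x" p] unfolding r_def by blast
    with \<open>r \<noteq> []\<close> that show False
      by (cases r) simp_all
  qed
  have fine: "\<not> ?D x" if "x \<in> set c" for x
  proof
    assume "?D x"
    \<comment> \<open>\<open>y\<close> is the first coarse vertex after the first coarse run and
      \<open>e\<close> the fine run before it; below, \<open>z\<close> is the last vertex of that
      coarse run.\<close>
    with that obtain e y f where c: "c = e @ y # f" "?D y" "\<forall>x\<in>set e. \<not> ?D x"
      using split_list_first_prop[of c ?D] by blast
    have "e \<noteq> []"
    proof
      assume "e = []"
      then have "hd c = y" "c \<noteq> []" using c(1) by simp_all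
      then show False
        using hd_dropWhile[of ?D r] c(2) unfolding c_def by blast
    qed
    have "takeWhile ?D r \<noteq> []"
      using empty that by auto
    then obtain b z where b: "takeWhile ?D r = b @ [z]"
      by (metis rev_exhaust)
    then have "?D z"
      by (metis in_set_conv_decomp set_takeWhileD)
    have ip: "ipath (M ^ Suc d) (tower K M (Suc d)) ([z] @ e @ [y])"
    proof (rule ipath_infix)
      have "p = (a @ b) @ ([z] @ e @ [y]) @ f"
        using p unfolding b c(1) by simp
      with assms show "ipath (M ^ Suc d) (tower K M (Suc d)) ((a @ b) @ ([z] @ e @ [y]) @ f)"
        by (simp only:)
    qed
    obtain q where q: "q < M" "set ([z] @ e @ [y]) \<subseteq> {q * M ^ d .. q * M ^ d + M ^ d}"
      by (rule ipath_fine[OF ip \<open>e \<noteq> []\<close>]) (use c(3) in auto)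
    have *: "x = q * M ^ d + 0 \<or> x = q * M ^ d + M ^ d" if "x \<in> {z, y}" for x
    proof -
      have "?D x" "x \<in> {q * M ^ d .. q * M ^ d + M ^ d}"
        using that \<open>?D z\<close> c(2) q(2) by auto
      then show ?thesis
        using fine_gap_ends[of x q "M ^ d"] M by simp
    qed
    have "z \<noteq> y"
      using ip by (auto simp: ipath_def)
    have "tower K M (Suc d) (q * M ^ d + 0) (q * M ^ d + M ^ d)"
      using tower_gap[OF q(1), of 0 d "M ^ d"] tower_ends[of d] by blast
    then have "tower K M (Suc d) z y"
      using *[of z] *[of y] \<open>z \<noteq> y\<close> tower_sym by blast
    moreover have "\<not> tower K M (Suc d) z y"
      using ipath_not_adjacent[OF _ \<open>e \<noteq> []\<close>] ip unfolding append_Cons append_Nil .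
    ultimately show False by blast
  qed
  show ?thesis
  proof (rule that[OF p empty])
    fix x assume "x \<in> set (takeWhile ?D r)"
    then show "?D x" using set_takeWhileD by metis
  next
    fix x assume "x \<in> set a \<union> set c"
    then show "\<not> ?D x"
      unfolding a_def using set_takeWhileD fine by (metis (no_types, lifting) UnE)
  qed
qed

lemma ipath_coarse:
  assumes "ipath (M ^ Suc d) (tower K M (Suc d)) p" and p: "\<And>x. x \<in> set p \<Longrightarrow> M ^ d dvd x"
  shows "ipath M K (map (\<lambda>x. x div M ^ d) p)"
proof (rule ipath_map[OF assms(1)])
  let ?L = "M ^ d"
  have L: "?L > 0" using M by simp
  show "inj_on (\<lambda>x. x div ?L) (set p)"
  proof (rule inj_onI)
    fix x y assume *: "x \<in> set p" "y \<in> set p" "x div ?L = y div ?L"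
    then have "x div ?L * ?L = y div ?L * ?L" by simp
    then show "x = y"
      using p *(1,2) by (simp only: dvd_div_mult_self)
  qed
  fix x y assume xy: "x \<in> set p" "y \<in> set p"
  have "x \<le> M * ?L"
    using assms(1) xy by (auto simp: ipath_def)
  then show "x div ?L \<le> M"
    using div_le_mono[of x "M * ?L" ?L] L by (simp only: nonzero_mult_div_cancel_right)
  show "K (x div ?L) (y div ?L) \<longleftrightarrow> tower K M (Suc d) x y"
    using tower_coarse[of d "x div ?L" "y div ?L"] p xy by (simp only: dvd_div_mult_self)
qed

text \<open>The whole list lies in one gap and \<open>z\<close> is an end of it, so the bound for
  paths starting at an end applies one level down. That bound is a hypothesis, so that it can be
  supplied by an induction hypothesis as well as by the finished lemma.\<close>

lemma ipath_fine_tail: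
  assumes ip: "ipath (M ^ Suc d) (tower K M (Suc d)) (z # c)"
    and "M ^ d dvd z" and c: "\<And>x. x \<in> set c \<Longrightarrow> \<not> M ^ d dvd x"
    and IH: "\<And>p. ipath (M ^ d) (tower K M d) p \<Longrightarrow> p \<noteq> [] \<Longrightarrow> hd p \<in> {0, M ^ d} \<Longrightarrow> length p \<le> e"
    and "e \<ge> 1"
  shows "Suc (length c) \<le> e"
proof (cases "c = []")
  case False
  have L: "M ^ d > 0" using M by simp
  obtain q where q: "q < M" "set (z # c) \<subseteq> {q * M ^ d .. q * M ^ d + M ^ d}"
    using ipath_fine[of d "[z]" c "[]"] ip c False by auto
  then have "z - q * M ^ d \<in> {0, M ^ d}"
    using fine_gap_ends[of z q "M ^ d"] assms(2) L by auto
  then have "length (map (\<lambda>x. x - q * M ^ d) (z # c)) \<le> e"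
    by (intro IH[OF ipath_gap[OF ip q]]) simp_all
  then show ?thesis by simp
qed (use assms in simp)

section \<open>Length of induced paths in a tower\<close>

text \<open>The path starts coarse, so it has no fine run in front. Its coarse run contains an end
  of \<open>K\<close> and has at most three vertices, the last of which also starts the descent; so
  a level costs two new vertices.\<close>

lemma ipath_tower_end:
  assumes "ipath (M ^ d) (tower K M d) p" and "p \<noteq> []" and "hd p \<in> {0, M ^ d}"
  shows "length p \<le> 2 * d + 2"
  using assms
proof (induction d arbitrary: p)
  case 0
  then have "card (set p) \<le> card {..1 :: nat}"
    by (intro card_mono) (auto simp: ipath_def)
  with 0 show ?case
    by (simp add: ipath_def distinct_card)
next
  case (Suc d)
  obtain a b c where *: "p = a @ b @ c" "b = [] \<Longrightarrow> c = []"
    "\<And>x. x \<in> set b \<Longrightarrow> M ^ d dvd x" "\<And>x. x \<in> set a \<union> set c \<Longrightarrow> \<not> M ^ d dvd x"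
    using coarse_contiguous[OF Suc.prems(1)] by metis
  have hd: "M ^ d dvd hd p"
    using Suc.prems(3) by auto
  have "a = []"
    using hd *(1) *(4)[of "hd p"] by (cases a) auto
  then have "b \<noteq> []"
    using * Suc.prems(2) by auto
  have "ipath (M ^ Suc d) (tower K M (Suc d)) b"
    using ipath_infix Suc.prems(1) *(1) by blast
  then have "ipath M K (map (\<lambda>x. x div M ^ d) b)"
    using ipath_coarse *(3) by blast
  moreover have "hd b = hd p"
    using \<open>a = []\<close> \<open>b \<noteq> []\<close> * by simp
  then have "hd b div M ^ d \<in> {0, M}"
    using Suc.prems(3) M by auto
  ultimately have 1: "length b \<le> 3"
    using ends_path[of "map (\<lambda>x. x div M ^ d) b" "hd b div M ^ d"] \<open>b \<noteq> []\<close> by simp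
  \<comment> \<open>The last coarse vertex is grouped with the fine tail, as the end through which
    the path enters the gap.\<close>
  have "butlast b @ (last b # c) @ [] = p"
    using \<open>a = []\<close> \<open>b \<noteq> []\<close> *(1) by (simp add: butlast_last_append)
  then have "ipath (M ^ Suc d) (tower K M (Suc d)) (last b # c)"
    using ipath_infix Suc.prems(1) by metis
  then have "Suc (length c) \<le> 2 * d + 2"
    by (rule ipath_fine_tail) (use * \<open>b \<noteq> []\<close> Suc.IH in auto)
  with 1 show ?case
    using *(1) \<open>a = []\<close> by simp
qed

text \<open>With a coarse run of at most \<open>g\<close> vertices, each of the two fine tails adds
  at most \<open>2 * d + 1\<close> by \<open>ipath_tower_end\<close>. Without a coarse vertex the
  path lies in one gap and induction applies.\<close>

lemma ipath_tower:
  assumes "ipath (M ^ d) (tower K M d) p" and "g \<ge> 2"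
    and g: "\<And>p. ipath M K p \<Longrightarrow> length p \<le> g"
  shows "length p \<le> g + 4 * d"
  using assms(1)
proof (induction d arbitrary: p)
  case 0
  then have "card (set p) \<le> card {..1 :: nat}"
    by (intro card_mono) (auto simp: ipath_def)
  with 0 show ?case
    using assms(2) by (simp add: ipath_def distinct_card)
next
  case (Suc d)
  obtain a b c where *: "p = a @ b @ c" "b = [] \<Longrightarrow> c = []"
    "\<And>x. x \<in> set b \<Longrightarrow> M ^ d dvd x" "\<And>x. x \<in> set a \<union> set c \<Longrightarrow> \<not> M ^ d dvd x"
    using coarse_contiguous[OF Suc.prems] by metis
  show ?case
  proof (cases "b = []")
    case True
    then have "p = a" using * by simp
    show ?thesis
    proof (cases "p = []")
      case False
      then obtain q where q: "q < M" "set p \<subseteq> {q * M ^ d .. q * M ^ d + M ^ d}"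
        using ipath_fine[of d "[]" p "[]"] Suc.prems *(4) \<open>p = a\<close> by auto
      then show ?thesis
        using Suc.IH[OF ipath_gap[OF Suc.prems q]] by simp
    qed simp
  next
    case False
    have "ipath (M ^ Suc d) (tower K M (Suc d)) b"
      using ipath_infix Suc.prems *(1) by blast
    then have "ipath M K (map (\<lambda>x. x div M ^ d) b)"
      using ipath_coarse *(3) by blast
    then have 1: "length b \<le> g"
      using g by fastforce
    have "(a @ butlast b) @ (last b # c) @ [] = p"
      using False *(1) by (simp add: butlast_last_append)
    then have "ipath (M ^ Suc d) (tower K M (Suc d)) (last b # c)"
      using ipath_infix Suc.prems by metis
    then have 2: "Suc (length c) \<le> 2 * d + 2"
      by (rule ipath_fine_tail) (use * False ipath_tower_end in auto)
    \<comment> \<open>Reversing the path turns the initial fine run into a tail.\<close>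
    have "rev (c) @ rev (tl b) @ (hd b # rev a) @ [] = rev p"
      using False *(1) by (cases b) auto
    then have "ipath (M ^ Suc d) (tower K M (Suc d)) (hd b # rev a)"
      using ipath_infix[of _ _ "rev c @ rev (tl b)" "hd b # rev a" "[]"] ipath_rev[OF Suc.prems] by simp
    then have "Suc (length (rev a)) \<le> 2 * d + 2"
      by (rule ipath_fine_tail) (use * False ipath_tower_end in auto)
    with 1 2 show ?thesis
      using *(1) by simp
  qed
qed

section \<open>Non-crossing classes of a tower\<close>

text \<open>The classes are reused on all levels: no coarse vertex lies strictly inside a gap and
  distinct gaps have disjoint interiors, so crossing edges are both coarse or both in the same
  gap.\<close>

lemma nc_colouring_tower:
  assumes "nc_colouring m K colK" and "m \<ge> 1"
  shows "\<exists>col. nc_colouring m (tower K M d) col"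
proof (induction d)
  case 0
  have "nc_colouring m (tower K M 0) (\<lambda>_ _. 0)"
    using assms(2) by (auto simp: nc_colouring_def)
  then show ?case by blast
next
  case (Suc d)
  then obtain col where col: "nc_colouring m (tower K M d) col" by blast
  let ?L = "M ^ d"
  have L: "?L > 0" using M by simp
  \<comment> \<open>For an edge with \<open>x < y\<close> that is not coarse,
    \<open>x div ?L\<close> is the index of its gap. An edge joining the two ends of a gap counts as
    coarse.\<close>
  define col' where "col' = (\<lambda>x y. if ?L dvd x \<and> ?L dvd y then colK (x div ?L) (y div ?L)
    else col (x - x div ?L * ?L) (y - x div ?L * ?L))"
  have coarse: "K (x div ?L) (y div ?L) \<and> col' x y = colK (x div ?L) (y div ?L)"
    if "tower K M (Suc d) x y" "?L dvd x" "?L dvd y" for x y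
    using that tower_coarse[of d "x div ?L" "y div ?L"]
    by (simp add: col'_def del: tower.simps)
  have fine: "\<exists>q. x div ?L = q \<and> q * ?L \<le> x \<and> y \<le> q * ?L + ?L \<and>
      tower K M d (x - q * ?L) (y - q * ?L) \<and> col' x y = col (x - q * ?L) (y - q * ?L)"
    if xy: "tower K M (Suc d) x y" "x < y" "\<not> (?L dvd x \<and> ?L dvd y)" for x y
  proof -
    \<comment> \<open>Whichever endpoint is not a multiple of \<open>?L\<close> determines the
      gap.\<close>
    have "\<exists>q<M. x \<in> {q * ?L .. q * ?L + ?L} \<and> y \<in> {q * ?L .. q * ?L + ?L}"
    proof (cases "?L dvd x")
      case False
      have "x = x div ?L * ?L + x mod ?L" by (rule div_mult_mod_eq[symmetric])
      moreover have "x mod ?L < ?L" using L by simp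
      ultimately have "x \<in> {x div ?L * ?L .. x div ?L * ?L + ?L}"
        by (metis atLeastAtMost_iff le_add1 less_imp_le nat_add_left_cancel_le)
      then show ?thesis using tower_fine[OF xy(1) False] by blast
    next
      case True
      then have nd: "\<not> ?L dvd y" using xy by simp
      have "y = y div ?L * ?L + y mod ?L" by (rule div_mult_mod_eq[symmetric])
      moreover have "y mod ?L < ?L" using L by simp
      ultimately have "y \<in> {y div ?L * ?L .. y div ?L * ?L + ?L}"
        by (metis atLeastAtMost_iff le_add1 less_imp_le nat_add_left_cancel_le)
      then show ?thesis using tower_fine[OF tower_sym[OF xy(1)] nd] by blast
    qed
    then obtain q where q: "q < M" "q * ?L \<le> x" "y \<le> q * ?L + ?L" by auto
    have "x div ?L = q"
      using q xy(2) by (intro div_nat_eqI) (auto simp: mult.commute)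
    moreover have "tower K M d (x - q * ?L) (y - q * ?L)"
      using tower_gap[OF q(1), of "x - q * ?L" d "y - q * ?L"] q xy by simp
    ultimately show ?thesis
      using q xy(3) by (auto simp: col'_def)
  qed
  have no_multiple: "\<not> ?L dvd z" if "q * ?L < z" "z < q * ?L + ?L" for q z
  proof
    assume "?L dvd z"
    then have "z = q * ?L + 0 \<or> z = q * ?L + ?L"
      using fine_gap_ends[of z q ?L] that L by simp
    with that show False by auto
  qed
  have "nc_colouring m (tower K M (Suc d)) col'"
    unfolding nc_colouring_def
  proof (intro conjI allI impI)
    fix x y assume xy: "x < y" "tower K M (Suc d) x y"
    show "col' x y < m"
    proof (cases "?L dvd x \<and> ?L dvd y")
      case True
      then have "x div ?L < y div ?L"
        using xy L by (auto elim!: dvdE)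
      then show ?thesis
        using coarse[OF xy(2)] True assms(1) by (simp add: nc_colouring_def)
    next
      case False
      then obtain q where q: "q * ?L \<le> x" "tower K M d (x - q * ?L) (y - q * ?L)"
          "col' x y = col (x - q * ?L) (y - q * ?L)"
        using fine[OF xy(2,1)] by blast
      moreover have "x - q * ?L < y - q * ?L"
        using xy(1) q(1) by linarith
      ultimately show ?thesis
        using col by (simp add: nc_colouring_def)
    qed
  next
    fix a b c e assume *: "a < c" "c < b" "b < e" "tower K M (Suc d) a b" "tower K M (Suc d) c e"
    consider "?L dvd a \<and> ?L dvd b" "?L dvd c \<and> ?L dvd e"
      | "?L dvd a \<and> ?L dvd b" "\<not> (?L dvd c \<and> ?L dvd e)"
      | "\<not> (?L dvd a \<and> ?L dvd b)" "?L dvd c \<and> ?L dvd e"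
      | "\<not> (?L dvd a \<and> ?L dvd b)" "\<not> (?L dvd c \<and> ?L dvd e)"
      by blast
    then show "col' a b \<noteq> col' c e"
    proof cases
      case 1
      then have "a div ?L < c div ?L" "c div ?L < b div ?L" "b div ?L < e div ?L"
        using * L by (auto elim!: dvdE)
      then show ?thesis
        using coarse[OF *(4)] coarse[OF *(5)] 1 assms(1) by (simp add: nc_colouring_def)
    next
      case 2
      then show ?thesis
        using fine[OF *(5)] * no_multiple[of "c div ?L" b] by fastforce
    next
      case 3
      then show ?thesis
        using fine[OF *(4)] * no_multiple[of "a div ?L" c] by fastforce
    next
      case 4
      obtain q where q: "a div ?L = q" "q * ?L \<le> a" "b \<le> q * ?L + ?L"
          "tower K M d (a - q * ?L) (b - q * ?L)" "col' a b = col (a - q * ?L) (b - q * ?L)"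
        using fine[OF *(4)] * 4 by fastforce
      obtain q' where q': "c div ?L = q'" "q' * ?L \<le> c" "e \<le> q' * ?L + ?L"
          "tower K M d (c - q' * ?L) (e - q' * ?L)" "col' c e = col (c - q' * ?L) (e - q' * ?L)"
        using fine[OF *(5)] * 4 by fastforce
      \<comment> \<open>\<open>c\<close> lies strictly between \<open>a\<close> and
        \<open>b\<close>, so the second edge belongs to the gap of the first.\<close>
      have "c div ?L = q"
        using q * by (intro div_nat_eqI) (auto simp: mult.commute)
      with q' have "q' = q" by simp
      have "a - q * ?L < c - q * ?L" "c - q * ?L < b - q * ?L" "b - q * ?L < e - q * ?L"
        using * q by linarith+
      then show ?thesis
        using q q' col \<open>q' = q\<close> by (auto simp: nc_colouring_def)
    qed
  qed
  then show ?case by blast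
qed

end

section \<open>Iterating the construction\<close>

lemma tower_base_apex:
  assumes "hgraph n R"
  shows "tower_base (n + 2) (apex n R)"
proof -
  interpret A: hgraph "n + 2" "apex n R"
    using assms by (rule apex_hgraph)
  show ?thesis
    by unfold_locales (auto simp: apex_def intro: ipath_apex_end)
qed

text \<open>One round of the construction. The colouring is assumed for \<open>apex n R\<close> and
  not for \<open>R\<close>, so that the triangle can enter with a single class.\<close>

lemma tower_apex:
  assumes "hgraph n R" and "\<And>p. ipath n R p \<Longrightarrow> length p \<le> g"
    and "nc_colouring m (apex n R) col" and "m \<ge> 1"
  shows "\<exists>R' col'. hgraph ((n + 2) ^ d) R' \<and>
    (\<forall>p. ipath ((n + 2) ^ d) R' p \<longrightarrow> length p \<le> max 3 g + 4 * d) \<and> nc_colouring m R' col'"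
proof -
  interpret tower_base "n + 2" "apex n R"
    using assms(1) by (rule tower_base_apex)
  have "length p \<le> max 3 g + 4 * d" if "ipath ((n + 2) ^ d) (tower (apex n R) (n + 2) d) p" for p
    using that ipath_apex[OF _ assms(1,2)] by (intro ipath_tower) auto
  then show ?thesis
    using tower_hgraph nc_colouring_tower[OF assms(3,4)] by blast
qed

text \<open>Each further round raises the lower bound on \<open>n\<close> to the power
  \<open>l\<close>, adds \<open>4 * l\<close> to the path bound and two classes. The 3 comes from
  the first round; afterwards the maximum with 3 in \<open>tower_apex\<close> has no effect.\<close>

lemma hgraph_exists:
  assumes "l \<ge> 1"
  shows "\<exists>n R col. hgraph n R \<and> 2 ^ l ^ Suc k \<le> n \<and>
    (\<forall>p. ipath n R p \<longrightarrow> length p \<le> 3 + 4 * l * Suc k) \<and> nc_colouring (2 * k + 1) R col"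
proof (induction k)
  case 0
  have "hgraph 0 (\<lambda>_ _. False)"
    by unfold_locales auto
  moreover have "length p \<le> 1" if "ipath 0 (\<lambda>_ _. False) p" for p
  proof -
    have "card (set p) \<le> card {0 :: nat}"
      using that by (intro card_mono) (auto simp: ipath_def)
    with that show ?thesis
      by (simp add: ipath_def distinct_card)
  qed
  ultimately obtain R col where "hgraph ((0 + 2) ^ l) R" "nc_colouring 1 R col"
    "\<forall>p. ipath ((0 + 2) ^ l) R p \<longrightarrow> length p \<le> max 3 1 + 4 * l"
    using tower_apex[OF _ _ nc_colouring_apex_vertex order_refl, of "\<lambda>_ _. False" 1 l] by blast
  then have "hgraph (2 ^ l) R \<and> nc_colouring 1 R col \<and>
      (\<forall>p. ipath (2 ^ l) R p \<longrightarrow> length p \<le> max 3 1 + 4 * l)"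
    by (simp only: add_0)
  then show ?case
    by (intro exI[of _ "2 ^ l"] exI[of _ R] exI[of _ col]) simp
next
  case (Suc k)
  then obtain n R col where *: "hgraph n R" "2 ^ l ^ Suc k \<le> n"
    "\<And>p. ipath n R p \<Longrightarrow> length p \<le> 3 + 4 * l * Suc k" "nc_colouring (2 * k + 1) R col"
    by blast
  obtain R' col' where "hgraph ((n + 2) ^ l) R'"
    "\<And>p. ipath ((n + 2) ^ l) R' p \<Longrightarrow> length p \<le> 3 + 4 * l * Suc (Suc k)"
    "nc_colouring (2 * Suc k + 1) R' col'"
    using tower_apex[OF *(1,3) nc_colouring_apex[OF *(4)], of l] by (auto simp: algebra_simps)
  moreover have "2 ^ l ^ Suc (Suc k) = ((2 :: nat) ^ l ^ Suc k) ^ l"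
    by (simp add: power_mult[symmetric] mult.commute mult.left_commute)
  then have "2 ^ l ^ Suc (Suc k) \<le> (n + 2) ^ l"
    using *(2) by (simp add: power_mono)
  ultimately show ?case by blast
qed

section \<open>From relations to ordered graphs given by edge sets\<close>

lemma induced_path_imp_ipath:
  assumes "hgraph n R" and "induced_path {..n} {{x, y} | x y. R x y} p"
  shows "ipath n R p"
proof -
  interpret hgraph n R by fact
  have p: "distinct p" "set p \<subseteq> {..n}"
    and E: "{e \<in> {{x, y} | x y. R x y}. e \<subseteq> set p} = path_edges p"
    using assms(2) by (auto simp: induced_path_def)
  have R: "{x, y} \<in> {{x, y} | x y. R x y} \<longleftrightarrow> R x y" for x y
    using sym by (auto simp: doubleton_eq_iff)
  have "R (p ! i) (p ! j) \<longleftrightarrow> i = Suc j \<or> j = Suc i" if "i < length p" "j < length p" for i j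
  proof -
    have "R (p ! i) (p ! j) \<longleftrightarrow> {p ! i, p ! j} \<in> path_edges p"
      using that R by (simp flip: E)
    also have "\<dots> \<longleftrightarrow> i = Suc j \<or> j = Suc i"
      using that p(1) by (auto simp: path_edges_def doubleton_eq_iff nth_eq_iff_index_eq)
    finally show ?thesis .
  qed
  with p show ?thesis
    by (simp add: ipath_def)
qed

lemma hgraph_ordered:
  assumes "hgraph n R" and "nc_colouring m R col"
  defines "E \<equiv> {{x, y} | x y. R x y}" and "r \<equiv> {(x, y). x < y \<and> y \<le> n}"
  shows "ordered_graph {..n} E r" and "ordered_along_hamiltonian_path {..n} E r"
    and "m_non_crossing m E r"
proof -
  interpret hgraph n R by fact
  have "{x, y} \<in> [{..n}]\<^bsup>2\<^esup>" if "R x y" for x y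
    using le[OF that] le[OF sym[OF that]] neq[OF that] by (simp add: nsets_def)
  then have "E \<subseteq> [{..n}]\<^bsup>2\<^esup>"
    by (auto simp: E_def)
  then show "ordered_graph {..n} E r"
    by (auto simp: ordered_graph_def fin_simple_graph_def r_def strict_linear_order_on_def
        trans_def irrefl_def total_on_def)
  have "sorted_wrt (\<lambda>a b. (a, b) \<in> r) [0..<Suc n]"
    by (auto simp: r_def sorted_wrt_iff_nth_less simp del: upt_Suc)
  moreover have "{i, Suc i} \<in> E" if "i < n" for i
    using consec[OF that] E_def by blast
  then have "path_edges [0..<Suc n] \<subseteq> E"
    by (auto simp: path_edges_def simp del: upt_Suc)
  ultimately show "ordered_along_hamiltonian_path {..n} E r"
    unfolding ordered_along_hamiltonian_path_def
    by (intro exI[of _ "[0..<Suc n]"]) (auto simp del: upt_Suc)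
  \<comment> \<open>The colour classes. They are disjoint because an edge determines its endpoints
    in increasing order, hence its colour.\<close>
  define P where "P = (\<lambda>i. {{x, y} | x y. x < y \<and> R x y \<and> col x y = i})"
  have P: "{x, y} \<in> (\<Union>i<m. P i)" if "x < y" "R x y" for x y
    using assms(2) that by (fastforce simp: P_def nc_colouring_def)
  have "e \<in> (\<Union>i<m. P i)" if "e \<in> E" for e
  proof -
    from that obtain x y where xy: "e = {x, y}" "R x y"
      unfolding E_def by blast
    show ?thesis
      using P[OF _ xy(2)] P[OF _ sym[OF xy(2)]] neq[OF xy(2)] xy(1)
      by (cases x y rule: linorder_cases) (simp_all add: insert_commute)
  qed
  moreover have "P i \<subseteq> E" for i
    unfolding P_def E_def by blast
  ultimately have "(\<Union>i<m. P i) = E"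
    by blast
  moreover have "disjoint_family_on P {..<m}"
    unfolding disjoint_family_on_def
  proof (intro ballI impI equals0I)
    fix i j e assume "i \<noteq> j" "e \<in> P i \<inter> P j"
    then show False
      by (auto simp: P_def doubleton_eq_iff)
  qed
  moreover have "non_crossing r (P i)" for i
  proof -
    have "\<not> crossing r e f" if "e \<in> P i" "f \<in> P i" for e f
    proof
      assume "crossing r e f"
      then obtain a b c d where *: "e = {a, b}" "f = {c, d}" "a < c" "c < b" "b < d"
        by (auto simp: crossing_def r_def)
      then have "R a b \<and> col a b = i" "R c d \<and> col c d = i"
        using that by (auto simp: P_def doubleton_eq_iff)
      then show False
        using assms(2) * unfolding nc_colouring_def by metis
    qed
    then show ?thesis by (auto simp: non_crossing_def)
  qed
  ultimately show "m_non_crossing m E r"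
    unfolding m_non_crossing_def by blast
qed

section \<open>Choice of parameters and the logarithmic bound\<close>

theorem corollary5p8:
  shows "\<forall>k :: nat. \<exists>C :: real. \<forall>N :: nat. \<exists>n \<ge> N.
    \<exists>(V :: nat set) (E :: nat set set) (r :: nat rel).
      ordered_graph V E r \<and> card V = n \<and>
      ordered_along_hamiltonian_path V E r \<and>
      m_non_crossing (2 * k + 1) E r \<and>
      (\<forall>p. induced_path V E p \<longrightarrow>
         real (length p) \<le> C * ln (real n) powr (1 / real (k + 1)))"
proof (intro allI)
  fix k :: nat
  \<comment> \<open>For \<open>l \<ge> 1\<close> the path bound \<open>3 + 4 * l * Suc k\<close> is
    at most \<open>7 * Suc k * l\<close>; dividing by \<open>ln 2\<close> pays for replacing
    \<open>l\<close> by the root of the logarithm.\<close>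
  let ?C = "real (7 * Suc k) / ln 2"
  show "\<exists>C :: real. \<forall>N :: nat. \<exists>n \<ge> N. \<exists>(V :: nat set) (E :: nat set set) (r :: nat rel).
      ordered_graph V E r \<and> card V = n \<and> ordered_along_hamiltonian_path V E r \<and>
      m_non_crossing (2 * k + 1) E r \<and>
      (\<forall>p. induced_path V E p \<longrightarrow> real (length p) \<le> C * ln (real n) powr (1 / real (k + 1)))"
  proof (intro exI[of _ ?C] allI)
    fix N :: nat
    \<comment> \<open>Makes \<open>l\<close> positive and the graph large enough, as
      \<open>N < l < 2 ^ l ^ Suc k \<le> n\<close>.\<close>
    define l where "l = Suc N"
    have l: "l \<ge> 1" by (simp add: l_def)
    obtain n R col where n: "hgraph n R" "2 ^ l ^ Suc k \<le> n"
      "\<And>p. ipath n R p \<Longrightarrow> length p \<le> 3 + 4 * l * Suc k" "nc_colouring (2 * k + 1) R col"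
      using hgraph_exists[OF l, of k] by blast
    have "l ^ 1 \<le> l ^ Suc k"
      using l by (intro power_increasing) auto
    then have "l < 2 ^ l ^ Suc k"
      using less_exp[of "l ^ Suc k"] by (simp only: power_one_right le_less_trans)
    then have "N \<le> Suc n"
      using n(2) by (simp add: l_def)
    \<comment> \<open>As \<open>ln 2\<close> is below 1, taking a root does not decrease it, so one
      factor \<open>ln 2\<close> serves for every \<open>k\<close>.\<close>
    have "ln 2 powr 1 \<le> ln 2 powr (1 / real (k + 1))"
      using ln_2_less_1 by (intro powr_mono') auto
    then have "real l * ln 2 \<le> real l * ln 2 powr (1 / real (k + 1))"
      by (intro mult_left_mono) simp_all
    also have "\<dots> = (real l ^ Suc k * ln 2) powr (1 / real (k + 1))"
    proof -
      have "real l ^ Suc k = real l powr real (k + 1)"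
        using l powr_realpow[of "real l" "Suc k"] by simp
      then have "(real l ^ Suc k) powr (1 / real (k + 1)) = real l"
        using l by (simp add: powr_powr del: power_Suc)
      then show ?thesis
        by (simp add: powr_mult del: power_Suc)
    qed
    also have "\<dots> = ln (2 ^ l ^ Suc k) powr (1 / real (k + 1))"
      by (simp add: ln_realpow)
    also have "\<dots> \<le> ln (real (Suc n)) powr (1 / real (k + 1))"
    proof (intro powr_mono2)
      have "real (2 ^ l ^ Suc k) \<le> real (Suc n)"
        using n(2) by (intro of_nat_mono) simp
      then show "ln (2 ^ l ^ Suc k) \<le> ln (real (Suc n))"
        by (subst ln_le_cancel_iff) auto
    qed auto
    finally have ln: "real l * ln 2 \<le> ln (real (Suc n)) powr (1 / real (k + 1))" .
    have short: "real (length p) \<le> ?C * ln (real (Suc n)) powr (1 / real (k + 1))"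
      if "induced_path {..n} {{x, y} | x y. R x y} p" for p
    proof -
      have "length p \<le> 3 + 4 * l * Suc k"
        using n(3) induced_path_imp_ipath[OF n(1) that] by blast
      also have "\<dots> \<le> 7 * Suc k * l"
        using mult_le_mono[OF l, of 1 "Suc k"] by (simp add: algebra_simps)
      finally have "real (length p) \<le> real (7 * Suc k) * real l"
        by (metis of_nat_le_iff of_nat_mult)
      also have "\<dots> = ?C * (real l * ln 2)"
        by simp
      also have "\<dots> \<le> ?C * ln (real (Suc n)) powr (1 / real (k + 1))"
        using ln by (intro mult_left_mono) auto
      finally show ?thesis .
    qed
    show "\<exists>n \<ge> N. \<exists>(V :: nat set) (E :: nat set set) (r :: nat rel).
      ordered_graph V E r \<and> card V = n \<and> ordered_along_hamiltonian_path V E r \<and>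
      m_non_crossing (2 * k + 1) E r \<and>
      (\<forall>p. induced_path V E p \<longrightarrow> real (length p) \<le> ?C * ln (real n) powr (1 / real (k + 1)))"
    proof (intro exI conjI allI impI)
      show "N \<le> Suc n" by fact
      show "card {..n} = Suc n" by simp
      show "real (length p) \<le> ?C * ln (real (Suc n)) powr (1 / real (k + 1))"
        if "induced_path {..n} {{x, y} | x y. R x y} p" for p
        using that by (rule short)
    qed (rule hgraph_ordered[OF n(1,4)])+
  qed
qed

end
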